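(* Let $p\equiv 1\pmod 6$ be a prime and let $a$ be an integer with $p\nmid a$. Then the number of points on the elliptic curve $y^{2}\equiv x^{3}+a^{3}\pmod p$ (counting the point at infinity) is $$1+\sum_{y\in\mathbb{F}_p} f(y^{2}-a^{3}),$$ where $$f(t)=\begin{cases}0 & \text{if } t\notin K_p,\\ 1 & \text{if } p\mid t,\\ 3 & \text{if } t\in K_p^{*}.\end{cases}$$
   Context: $K_p$ denotes the set of cubic residues modulo $p$, i.e. the set of cubes in $\mathbb{F}_p$ (including $0$), and $K_p^{*}=K_p\setminus\{0\}$ is the set of nonzero cubic residues. The points on the curve modulo $p$ are the pairs $(x,y)\in\mathbb{F}_p\times\mathbb{F}_p$ satisfying the congruence, together with one point at infinity. *)

theory Defs
  imports "HOL-Number_Theory.Number_Theory"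
begin

text \<open>
  The field with \<open>p\<close> elements is represented by the least nonnegative residues, i.e. by the
  carrier \<open>{0..p - 1}\<close> of the library's \<^const>\<open>residue_ring\<close>. An arbitrary integer \<open>t\<close> stands for
  the element \<open>t mod p\<close>.
\<close>

abbreviation Fp :: "int \<Rightarrow> int set" where
  "Fp p \<equiv> carrier (residue_ring p)"

definition cubic_residues :: "int \<Rightarrow> int set" where
  "cubic_residues p = {x ^ 3 mod p | x. x \<in> Fp p}"

definition nonzero_cubic_residues :: "int \<Rightarrow> int set" where
  "nonzero_cubic_residues p = cubic_residues p - {0}"

text \<open>The last case is \<open>t mod p \<notin> cubic_residues p\<close>, as \<open>0\<close> is a cubic residue.\<close>

definition cubic_weight :: "int \<Rightarrow> int \<Rightarrow> nat" where
  "cubic_weight p t =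
     (if p dvd t then 1
      else if t mod p \<in> nonzero_cubic_residues p then 3
      else 0)"

text \<open>
  The points modulo \<open>p\<close> of the curve \<open>y\<^sup>2 = x\<^sup>3 + b\<close>; \<^const>\<open>None\<close> is the point at infinity.
\<close>

definition curve_points :: "int \<Rightarrow> int \<Rightarrow> (int \<times> int) option set" where
  "curve_points p b =
     insert None (Some ` {(x, y). x \<in> Fp p \<and> y \<in> Fp p \<and> [y ^ 2 = x ^ 3 + b] (mod p)})"

end

theory Submission
  imports Defs
begin

text \<open>
  Sorting the affine points of \<open>y\<^sup>2 = x\<^sup>3 + b\<close> by their second coordinate, the fibre over \<open>y\<close>
  consists of the cube roots of \<open>y\<^sup>2 - b\<close> in \<open>Fp p\<close>, so everything reduces to counting the cube
  roots of a given \<open>t\<close>. If \<open>p\<close> divides \<open>t\<close>, only \<open>0\<close> qualifies. If \<open>t\<close> is not a cube, there is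
  none. If \<open>t\<close> is the nonzero cube \<open>r\<^sup>3\<close>, the congruence \<open>p \<equiv> 1 (mod 3)\<close> provides a
  primitive cube root of unity \<open>w\<close>, a power of a primitive root (lemma
  \<open>primitive_cube_root_of_unity_exists\<close>), and
  \<open>x\<^sup>3 - r\<^sup>3 = (x - r) (x - w r) (x - w\<^sup>2 r)\<close> in the field shows that the cube roots are
  exactly the three distinct elements \<open>r\<close>, \<open>w r\<close>, \<open>w\<^sup>2 r\<close> (lemma \<open>card_cube_roots\<close>).
\<close>

lemma Fp_eq: "Fp p = {0..p - 1}"
  by (simp add: residue_ring_def)

text \<open>
  The witness is \<open>g ^ ((p - 1) / 3)\<close> for a primitive root \<open>g\<close>: its cube is \<open>1\<close> by Fermat, and it
  is not \<open>1\<close> because its exponent is positive and smaller than the order of \<open>g\<close>. It is recorded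
  as a root of \<open>w\<^sup>2 + w + 1\<close>, the cofactor of \<open>w - 1\<close> in \<open>w\<^sup>3 - 1\<close>, since this
  is the form in which it enters the factorization of \<open>x\<^sup>3 - r\<^sup>3\<close>.
\<close>

lemma primitive_cube_root_of_unity_exists:
  fixes p :: int
  assumes "prime p" and "[p = 1] (mod 3)"
  obtains w where "p dvd w ^ 2 + w + 1" and "\<not> p dvd w - 1"
proof -
  define q where "q = nat p"
  have q: "prime q"
    using assms(1) prime_int_nat_transfer[of p] unfolding q_def by blast
  have pq: "p = int q"
    using prime_ge_0_int[OF assms(1)] by (simp add: q_def)
  obtain g where g: "residue_primroot q g"
    using prime_primitive_root_exists[of q] q prime_gt_1_nat[OF q] by auto
  have ord_g: "ord q g = q - 1"
    using g q by (simp add: residue_primroot_def totient_prime)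
  define m where "m = (q - 1) div 3"
  have "int (q mod 3) = int 1"
    using assms(2) by (simp add: pq cong_def zmod_int)
  hence "q mod 3 = 1"
    by (simp only: of_nat_eq_iff)
  hence m: "q - 1 = m * 3" and m_pos: "m > 0"
    using prime_gt_1_nat[OF q] unfolding m_def by presburger+
  have "[g ^ (m * 3) = 1] (mod q)"
    using ord_divides[of g "m * 3" q] ord_g m by simp
  hence "[int (g ^ (m * 3)) = int 1] (mod int q)"
    by (simp only: cong_int_iff)
  hence "p dvd (int g ^ m) ^ 3 - 1"
    by (simp add: pq cong_iff_dvd_diff power_mult)
  also have "(int g ^ m) ^ 3 - 1 = (int g ^ m - 1) * ((int g ^ m) ^ 2 + int g ^ m + 1)"
    by (simp add: algebra_simps power2_eq_square power3_eq_cube)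
  finally have prod: "p dvd (int g ^ m - 1) * ((int g ^ m) ^ 2 + int g ^ m + 1)" .
  have "\<not> (q - 1) dvd m"
    using m m_pos dvd_imp_le[of "q - 1" m] by linarith
  hence "\<not> [g ^ m = 1] (mod q)"
    using ord_divides[of g m q] ord_g by simp
  hence "\<not> [int (g ^ m) = int 1] (mod int q)"
    by (simp only: cong_int_iff not_False_eq_True)
  hence "\<not> p dvd int g ^ m - 1"
    by (simp add: pq cong_iff_dvd_diff)
  with prod assms(1) show thesis
    by (intro that) (auto simp: prime_dvd_mult_iff)
qed

text \<open>
  The cube roots \<open>r\<close>, \<open>w r\<close>, \<open>w\<^sup>2 r\<close> are distinct because \<open>p\<close> does not divide \<open>r\<close> and \<open>w\<close> is
  congruent to none of \<open>0\<close>, \<open>1\<close>, \<open>-1\<close>: at \<open>0\<close> and at \<open>-1\<close> the polynomial \<open>w\<^sup>2 + w + 1\<close>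
  takes the value \<open>1\<close>.
\<close>

lemma card_cube_roots:
  fixes p r :: int
  assumes p: "prime p" and "[p = 1] (mod 3)" and r: "\<not> p dvd r"
  shows "card {x \<in> Fp p. [x ^ 3 = r ^ 3] (mod p)} = 3"
proof -
  obtain w where w: "p dvd w ^ 2 + w + 1" and w1: "\<not> p dvd w - 1"
    using primitive_cube_root_of_unity_exists[OF assms(1,2)] .
  have w0: "\<not> p dvd w"
  proof
    assume "p dvd w"
    hence "p dvd (w ^ 2 + w + 1) - w * (w + 1)"
      using w by (intro dvd_diff) auto
    thus False
      using prime_gt_1_int[OF p] by (simp add: algebra_simps power2_eq_square)
  qed
  have w_minus1: "\<not> p dvd w + 1"
  proof
    assume "p dvd w + 1"
    hence "p dvd (w ^ 2 + w + 1) - w * (w + 1)"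
      using w by (intro dvd_diff) auto
    thus False
      using prime_gt_1_int[OF p] by (simp add: algebra_simps power2_eq_square)
  qed
  have factor: "[x ^ 3 = r ^ 3] (mod p) \<longleftrightarrow>
      [x = r] (mod p) \<or> [x = w * r] (mod p) \<or> [x = w ^ 2 * r] (mod p)" for x
  proof -
    \<comment> \<open>Expanding \<open>(x - r) (x - w r) (x - w\<^sup>2 r)\<close> leaves this multiple of \<open>w\<^sup>2 + w + 1\<close>.\<close>
    have "x ^ 3 - r ^ 3 = (x - r) * ((x - w * r) * (x - w ^ 2 * r))
        + (w ^ 2 + w + 1) * (r * x ^ 2 - w * r ^ 2 * x + (w - 1) * r ^ 3)"
      by (simp add: algebra_simps power2_eq_square power3_eq_cube)
    hence "p dvd x ^ 3 - r ^ 3 \<longleftrightarrow> p dvd (x - r) * ((x - w * r) * (x - w ^ 2 * r))"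
      using w by (simp add: dvd_add_left_iff)
    thus ?thesis
      using p by (simp add: cong_iff_dvd_diff prime_dvd_mult_iff)
  qed
  have p_pos: "p > 0"
    using p by (simp add: prime_gt_0_int)
  have reduce: "x \<in> Fp p \<and> [x = y] (mod p) \<longleftrightarrow> x = y mod p" for x y
    using p_pos by (auto simp: Fp_eq cong_def)
  have "{x \<in> Fp p. [x ^ 3 = r ^ 3] (mod p)} = {r mod p, (w * r) mod p, (w ^ 2 * r) mod p}"
  proof (rule Set.set_eqI)
    fix x
    show "x \<in> {x \<in> Fp p. [x ^ 3 = r ^ 3] (mod p)} \<longleftrightarrow>
        x \<in> {r mod p, (w * r) mod p, (w ^ 2 * r) mod p}"
      using reduce[of x r] reduce[of x "w * r"] reduce[of x "w ^ 2 * r"]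
      unfolding mem_Collect_eq factor insert_iff empty_iff by blast
  qed
  moreover have "r mod p \<noteq> (w * r) mod p"
  proof
    assume "r mod p = (w * r) mod p"
    hence "p dvd w * r - r"
      by (metis mod_eq_dvd_iff)
    also have "w * r - r = (w - 1) * r" by (simp add: algebra_simps)
    finally show False using p r w1 by (simp add: prime_dvd_mult_iff)
  qed
  moreover have "r mod p \<noteq> (w ^ 2 * r) mod p"
  proof
    assume "r mod p = (w ^ 2 * r) mod p"
    hence "p dvd w ^ 2 * r - r"
      by (metis mod_eq_dvd_iff)
    also have "w ^ 2 * r - r = (w - 1) * (w + 1) * r"
      by (simp add: algebra_simps power2_eq_square)
    finally show False using p r w1 w_minus1 by (simp add: prime_dvd_mult_iff)
  qed
  moreover have "(w * r) mod p \<noteq> (w ^ 2 * r) mod p"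
  proof
    assume "(w * r) mod p = (w ^ 2 * r) mod p"
    hence "p dvd w ^ 2 * r - w * r"
      by (metis mod_eq_dvd_iff)
    also have "w ^ 2 * r - w * r = w * (w - 1) * r"
      by (simp add: algebra_simps power2_eq_square)
    finally show False using p r w0 w1 by (simp add: prime_dvd_mult_iff)
  qed
  ultimately show ?thesis by simp
qed

lemma cubic_weight_eq_card_cube_roots:
  fixes p t :: int
  assumes p: "prime p" and "[p = 1] (mod 3)"
  shows "cubic_weight p t = card {x \<in> Fp p. [x ^ 3 = t] (mod p)}"
proof -
  have p_pos: "p > 0"
    using p by (simp add: prime_gt_0_int)
  consider (zero) "p dvd t"
    | (cube) r where "\<not> p dvd t" "r \<in> Fp p" "[r ^ 3 = t] (mod p)"
    | (noncube) "\<not> p dvd t" "\<And>r. r \<in> Fp p \<Longrightarrow> \<not> [r ^ 3 = t] (mod p)"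
    by blast
  thus ?thesis
  proof cases
    case zero
    have "[x ^ 3 = t] (mod p) \<longleftrightarrow> p dvd x" for x
      using zero p by (simp add: cong_def dvd_eq_mod_eq_0[symmetric] prime_dvd_power_iff)
    moreover have "x \<in> Fp p \<and> p dvd x \<longleftrightarrow> x = 0" for x
      using p_pos zdvd_not_zless[of x p] by (fastforce simp: Fp_eq)
    ultimately have "{x \<in> Fp p. [x ^ 3 = t] (mod p)} = {0}"
      by blast
    thus ?thesis
      using zero by (simp add: cubic_weight_def)
  next
    case cube
    have "p dvd r ^ 3 \<longleftrightarrow> p dvd t"
      using cube(3) by (rule cong_dvd_iff)
    hence "\<not> p dvd r"
      using cube(1) p by (simp add: prime_dvd_power_iff)
    moreover have "{x \<in> Fp p. [x ^ 3 = t] (mod p)} = {x \<in> Fp p. [x ^ 3 = r ^ 3] (mod p)}"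
      using cube(3) by (auto simp: cong_def)
    moreover have "t mod p \<in> nonzero_cubic_residues p"
      using cube by (auto simp: nonzero_cubic_residues_def cubic_residues_def cong_def
          dvd_eq_mod_eq_0 intro!: exI[of _ r])
    ultimately show ?thesis
      using cube(1) assms by (simp add: cubic_weight_def card_cube_roots)
  next
    case noncube
    have "t mod p \<notin> nonzero_cubic_residues p"
      using noncube(2) unfolding nonzero_cubic_residues_def cubic_residues_def cong_def by force
    moreover have "{x \<in> Fp p. [x ^ 3 = t] (mod p)} = {}"
      using noncube(2) by blast
    ultimately show ?thesis
      using noncube(1) by (simp only: cubic_weight_def) simp
  qed
qed

lemma card_curve_points:
  "card (curve_points p b) = 1 + (\<Sum>y\<in>Fp p. card {x \<in> Fp p. [x ^ 3 = y ^ 2 - b] (mod p)})"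
proof -
  define A where "A = {(x, y). x \<in> Fp p \<and> y \<in> Fp p \<and> [y ^ 2 = x ^ 3 + b] (mod p)}"
  define B where "B = (SIGMA y:Fp p. {x \<in> Fp p. [x ^ 3 = y ^ 2 - b] (mod p)})"
  have shift: "[y ^ 2 = x ^ 3 + b] (mod p) \<longleftrightarrow> [x ^ 3 = y ^ 2 - b] (mod p)" for x y
    by (subst cong_sym_eq) (simp add: cong_iff_dvd_diff algebra_simps)
  have A: "A = prod.swap ` B"
    unfolding A_def B_def shift by force
  have finite_Fp: "finite (Fp p)"
    by (simp add: Fp_eq)
  have "finite B"
    unfolding B_def using finite_Fp by auto
  hence "finite A" by (simp add: A)
  have "card (curve_points p b) = 1 + card (Some ` A)"
    unfolding curve_points_def A_def[symmetric]
    using \<open>finite A\<close> by (subst card_insert_disjoint) auto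
  also have "card (Some ` A) = card B"
    by (simp add: card_image A)
  also have "card B = (\<Sum>y\<in>Fp p. card {x \<in> Fp p. [x ^ 3 = y ^ 2 - b] (mod p)})"
    unfolding B_def using finite_Fp by (intro card_SigmaI) auto
  finally show ?thesis .
qed

theorem theorem4:
  fixes p a :: int
  assumes "prime p" and "[p = 1] (mod 6)" and "\<not> p dvd a"
  shows "card (curve_points p (a ^ 3)) = 1 + (\<Sum>y\<in>Fp p. cubic_weight p (y ^ 2 - a ^ 3))"
proof -
  have "[p = 1] (mod 3)"
    by (rule cong_dvd_modulus[OF assms(2)]) simp
  thus ?thesis
    using assms(1) by (simp only: card_curve_points cubic_weight_eq_card_cube_roots)
qed

end
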